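(* Let $H:=\sup_{i\in\Sigma}\sum_{n=0}^\infty l(i|n)$ be the height of an (unperturbed) multiplicative cascade. Then: (a) if $\sum_{i\in S}P(w(i)=1)<1$, then $E(H^d)<\infty$ for all $d\in\mathbb{R}$; (b) if $\sum_{i\in S}P(w(i)=1)=1$, then $E(H)=\infty$; (c) if $\sum_{i\in S}P(w(i)=1)>1$, then $P(H=\infty)>0$.
   Context: $S$ is a finite index set with $N:=|S|$ elements. $\Sigma_n:=S^n$ (with $\Sigma_0:=\{\emptyset\}$), $\Sigma_*:=\bigcup_{n\geq0}\Sigma_n$, $\Sigma:=S^{\mathbb{N}}$; $i|m$ is the truncation of $i$ to its first $m$ letters. A multiplicative cascade is a family of random variables $(w(i))_{i\in\Sigma_*\setminus\{\emptyset\}}$ with values in $[0,1]$ such that the $N$-tuples $(w(ij))_{j\in S}$, $i\in\Sigma_*$, are independent copies of $(w(j))_{j\in S}$ (no independence is assumed within a tuple). $l(\emptyset):=1$ and $l(i):=w(i|1)w(i|2)\cdots w(i)$ for $i\in\Sigma_*\setminus\{\emptyset\}$. *)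

theory Defs
  imports "HOL-Probability.Probability"
begin

text \<open>
  Finite words over \<open>S\<close> are the elements of \<^term>\<open>lists S\<close>, infinite words are functions from \<^typ>\<open>nat\<close>
  to \<open>S\<close>, with letters numbered from \<open>0\<close>. Only the values of \<open>w\<close> at nonempty words over \<open>S\<close> matter:
  these are exactly the words \<open>i @ [j]\<close> with \<open>i\<close> in \<^term>\<open>lists S\<close> and \<open>j\<close> in \<open>S\<close>.
\<close>

locale multiplicative_cascade = prob_space M
  for M :: "'w measure" and S :: "'s set" and w :: "'s list \<Rightarrow> 'w \<Rightarrow> real" +
  assumes finite_S: "finite S"
    and S_nonempty: "S \<noteq> {}"
    and w_range: "\<And>i j \<omega>. i \<in> lists S \<Longrightarrow> j \<in> S \<Longrightarrow> \<omega> \<in> space M \<Longrightarrow> w (i @ [j]) \<omega> \<in> {0..1}"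
    and indep_tuples:
      "indep_vars (\<lambda>i. Pi\<^sub>M S (\<lambda>j. borel)) (\<lambda>i \<omega>. \<lambda>j\<in>S. w (i @ [j]) \<omega>) (lists S)"
    and identically_distributed:
      "\<And>i. i \<in> lists S \<Longrightarrow>
        distr M (Pi\<^sub>M S (\<lambda>j. borel)) (\<lambda>\<omega>. \<lambda>j\<in>S. w (i @ [j]) \<omega>) =
        distr M (Pi\<^sub>M S (\<lambda>j. borel)) (\<lambda>\<omega>. \<lambda>j\<in>S. w [j] \<omega>)"

definition truncation :: "(nat \<Rightarrow> 's) \<Rightarrow> nat \<Rightarrow> 's list" where
  "truncation i m = map i [0..<m]"

definition cascade_length :: "('s list \<Rightarrow> 'w \<Rightarrow> real) \<Rightarrow> 's list \<Rightarrow> 'w \<Rightarrow> real" where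
  "cascade_length w i \<omega> = (\<Prod>k = 1..length i. w (take k i) \<omega>)"

definition cascade_height :: "'s set \<Rightarrow> ('s list \<Rightarrow> 'w \<Rightarrow> real) \<Rightarrow> 'w \<Rightarrow> ennreal" where
  "cascade_height S w \<omega> =
    (SUP i \<in> UNIV \<rightarrow> S. \<Sum>n. ennreal (cascade_length w (truncation i n) \<omega>))"

text \<open>
  Real powers on \<open>[0, \<infinity>]\<close>, with \<open>x\<^sup>0 = 1\<close> for all \<open>x\<close>, \<open>0\<^sup>d = \<infinity>\<close> and \<open>\<infinity>\<^sup>d = 0\<close> for \<open>d < 0\<close>,
  and \<open>\<infinity>\<^sup>d = \<infinity>\<close> for \<open>d > 0\<close>. The case \<open>d = 0\<close> is separate because \<open>0 powr 0 = 0\<close> for reals.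
\<close>

definition ennreal_powr :: "ennreal \<Rightarrow> real \<Rightarrow> ennreal" where
  "ennreal_powr x d =
    (if d = 0 then 1
     else if x = 0 \<and> d < 0 then \<infinity>
     else if x = \<infinity> then (if d > 0 then \<infinity> else 0)
     else ennreal (enn2real x powr d))"

text \<open>
  The height is a supremum over an uncountable set, but it is nevertheless a random variable, because
  its partial sums up to level \<open>n\<close> depend only on finite words. Hence integrals and probabilities of
  events in terms of it have their usual meaning.
\<close>

lemma (in multiplicative_cascade) measurable_w:
  assumes "i \<in> lists S" "j \<in> S"
  shows "w (i @ [j]) \<in> borel_measurable M"
proof -
  have "(\<lambda>\<omega>. \<lambda>j\<in>S. w (i @ [j]) \<omega>) \<in> measurable M (Pi\<^sub>M S (\<lambda>j. borel))"
    using indep_tuples assms(1) unfolding indep_vars_def by auto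
  from measurable_compose[OF this measurable_component_singleton[OF assms(2)]]
  show ?thesis using assms(2) by simp
qed

lemma (in multiplicative_cascade) measurable_cascade_length:
  assumes "i \<in> lists S"
  shows "cascade_length w i \<in> borel_measurable M"
proof -
  have "w (take k i) \<in> borel_measurable M" if "k \<in> {1..length i}" for k
  proof -
    obtain m where m: "k = Suc m" "m < length i" using \<open>k \<in> _\<close> by (cases k) auto
    have "take m i \<in> lists S" "i ! m \<in> S" using assms m by (auto dest: in_set_takeD)
    from measurable_w[OF this] show ?thesis using m by (simp add: take_Suc_conv_app_nth)
  qed
  then have "(\<lambda>\<omega>. \<Prod>k = 1..length i. w (take k i) \<omega>) \<in> borel_measurable M"
    by (intro borel_measurable_prod) auto
  then show ?thesis by (simp add: cascade_length_def[abs_def])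
qed

lemma (in multiplicative_cascade) measurable_cascade_height:
  "cascade_height S w \<in> borel_measurable M"
proof -
  define g where "g n u \<omega> = (\<Sum>k<n. ennreal (cascade_length w (take k u) \<omega>))" for n u \<omega>
  define T where "T n = (\<lambda>i. truncation i n) ` (UNIV \<rightarrow> S)" for n
  have T: "T n \<subseteq> lists S" for n unfolding T_def truncation_def by (auto simp: Pi_iff)
  have cT: "countable (T n)" for n
    by (rule countable_subset[OF T]) (simp add: countable_finite finite_S countable_lists)
  have eq: "cascade_height S w \<omega> = (SUP n. SUP u \<in> T n. g n u \<omega>)" for \<omega>
  proof -
    have tt: "take k (truncation i n) = truncation i k" if "k < n" for k n and i :: "nat \<Rightarrow> 's"
      using that by (simp add: truncation_def take_map)
    have "cascade_height S w \<omega> = (SUP i \<in> UNIV \<rightarrow> S. SUP n. g n (truncation i n) \<omega>)"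
      unfolding cascade_height_def g_def
      by (simp add: suminf_eq_SUP tt)
    also have "\<dots> = (SUP n. SUP i \<in> UNIV \<rightarrow> S. g n (truncation i n) \<omega>)"
      by (rule SUP_commute)
    finally show ?thesis by (simp add: T_def image_comp)
  qed
  have "g n u \<in> borel_measurable M" if "u \<in> T n" for n u
  proof -
    have "take k u \<in> lists S" for k using T that by (auto dest: in_set_takeD)
    then have "(\<lambda>\<omega>. cascade_length w (take k u) \<omega>) \<in> borel_measurable M" for k
      by (rule measurable_cascade_length)
    then show ?thesis unfolding g_def[abs_def] by measurable
  qed
  then have "(\<lambda>\<omega>. SUP n. SUP u \<in> T n. g n u \<omega>) \<in> borel_measurable M"
    by (intro borel_measurable_SUP) (auto simp: cT)
  then show ?thesis by (simp add: eq cong: measurable_cong)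
qed

end

theory Submission
  imports Defs
begin

text \<open>
  (a) Choose \<open>p\<close> with \<open>\<Sum>j. E (w j)\<^sup>p < r < 1\<close>. If \<open>Y = \<Sum>n. \<Sum>|u| = n. l(u)\<^sup>p / r\<^sup>n\<close>, then \<open>E Y\<close> is a convergent
  geometric series, and \<open>l(u) \<le> r\<^sup>n\<^sup>/\<^sup>p Y\<^sup>1\<^sup>/\<^sup>p\<close> for \<open>|u| = n\<close>, so \<open>H\<^sup>p\<close> is at most a constant times \<open>Y\<close>.

  (b), (c) The words along which all weights equal \<open>1\<close> form a Galton-Watson tree with mean offspring
  \<open>m = \<Sum>j. P (w j = 1)\<close> and at most \<open>N\<close> children per node. If the tree reaches level \<open>n\<close>, then \<open>H > n\<close>.
  Its probability \<open>s\<^sub>n\<close> of reaching level \<open>n\<close> satisfies \<open>s\<^sub>n\<^sub>+\<^sub>1 \<ge> m s\<^sub>n - N\<^sup>2 s\<^sub>n\<^sup>2\<close>. Hence \<open>s\<^sub>n\<close> is bounded away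
  from \<open>0\<close> if \<open>m > 1\<close>, and \<open>s\<^sub>n\<close> is at least a multiple of \<open>1 / n\<close> if \<open>m = 1\<close>, so \<open>E H \<ge> \<Sum>n. s\<^sub>n = \<infinity>\<close>.
\<close>

section \<open>Two elementary facts: sums over words and a second-order bound\<close>

text \<open>Distributive law: expanding the power produces one monomial per word of length
  \<open>n\<close>. It turns the sum of the moments over a whole level into a power of the sum over
  one tuple.\<close>

lemma sum_prod_list_words:
  fixes f :: "'a \<Rightarrow> 'b::comm_semiring_1"
  shows "(\<Sum>u | set u \<subseteq> S \<and> length u = n. prod_list (map f u)) = (\<Sum>j\<in>S. f j) ^ n"
proof (induction n)
  case 0
  have "{u. set u \<subseteq> S \<and> length u = 0} = {[]}" by auto
  then show ?case by simp
next
  case (Suc n)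
  have "(\<Sum>u | set u \<subseteq> S \<and> length u = Suc n. prod_list (map f u)) =
      (\<Sum>(u, j) \<in> {u. set u \<subseteq> S \<and> length u = n} \<times> S. prod_list (map f u) * f j)"
    unfolding lists_length_Suc_eq
    by (subst sum.reindex) (auto simp: inj_on_def case_prod_beta mult.commute)
  also have "\<dots> = (\<Sum>u | set u \<subseteq> S \<and> length u = n. prod_list (map f u)) * (\<Sum>j\<in>S. f j)"
    by (simp add: sum.cartesian_product[symmetric] sum_product)
  finally show ?case using Suc by (simp add: mult.commute)
qed

text \<open>Counterpart to Bernoulli's inequality. The generous coefficient \<open>k\<^sup>2\<close>
  (in place of k choose 2) makes the error dropped in the induction step visibly
  nonnegative.\<close>

lemma power_one_minus_le:
  fixes s :: real
  assumes "0 \<le> s" "s \<le> 1"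
  shows "(1 - s) ^ k \<le> 1 - real k * s + (real k)\<^sup>2 * s\<^sup>2"
proof (induction k)
  case (Suc k)
  have "(1 - s) ^ Suc k \<le> (1 - s) * (1 - real k * s + (real k)\<^sup>2 * s\<^sup>2)"
    using Suc assms by (auto intro: mult_left_mono)
  also have "\<dots> = 1 - real (Suc k) * s + (real (Suc k))\<^sup>2 * s\<^sup>2 - ((real k + 1) * s\<^sup>2 + (real k)\<^sup>2 * s ^ 3)"
    by (simp add: algebra_simps power2_eq_square power3_eq_cube)
  also have "\<dots> \<le> 1 - real (Suc k) * s + (real (Suc k))\<^sup>2 * s\<^sup>2"
  proof -
    have "0 \<le> (real k + 1) * s\<^sup>2 + (real k)\<^sup>2 * s ^ 3" using assms by auto
    then show ?thesis by linarith
  qed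
  finally show ?case .
qed auto

section \<open>Basic bounds for lengths and height; the common law of the tuples\<close>

context multiplicative_cascade
begin

lemma w_bounds:
  assumes "v \<in> lists S" "j \<in> S" "\<omega> \<in> space M"
  shows "0 \<le> w (v @ [j]) \<omega>" "w (v @ [j]) \<omega> \<le> 1"
  using w_range[OF assms] by auto

lemma cascade_length_append:
  "cascade_length w (u @ [j]) \<omega> = cascade_length w u \<omega> * w (u @ [j]) \<omega>"
proof -
  have "(\<Prod>k = 1..length u. w (take k (u @ [j])) \<omega>) = (\<Prod>k = 1..length u. w (take k u) \<omega>)"
    by (intro prod.cong) auto
  then show ?thesis by (simp add: cascade_length_def)
qed

lemma cascade_length_nonneg:
  assumes "u \<in> lists S" "\<omega> \<in> space M"
  shows "0 \<le> cascade_length w u \<omega>"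
  using assms(1)
proof (induction u rule: rev_induct)
  case (snoc j u)
  then show ?case using w_bounds[of u j \<omega>] assms(2) by (simp add: cascade_length_append)
qed (simp add: cascade_length_def)

lemma cascade_height_ge:
  assumes u: "u \<in> lists S" and le: "n \<le> Suc (length u)"
  shows "(\<Sum>k<n. ennreal (cascade_length w (take k u) \<omega>)) \<le> cascade_height S w \<omega>"
proof -
  obtain s where s: "s \<in> S" using S_nonempty by auto
  \<comment> \<open>The height ranges over infinite words, so \<open>u\<close> is padded with an
    arbitrary letter. The truncations agree with prefixes of \<open>u\<close> up to and including
    level \<open>length u\<close>, whence the bound \<open>Suc (length u)\<close> on
    \<open>n\<close>.\<close>
  define i where "i k = (if k < length u then u ! k else s)" for k
  have i: "i \<in> UNIV \<rightarrow> S" using u s by (auto simp: i_def in_lists_conv_set)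
  have t: "truncation i k = take k u" if "k < n" for k
    using that le by (intro nth_equalityI) (auto simp: truncation_def i_def)
  have "(\<Sum>k<n. ennreal (cascade_length w (take k u) \<omega>)) =
      (\<Sum>k<n. ennreal (cascade_length w (truncation i k) \<omega>))"
    by (simp add: t)
  also have "\<dots> \<le> (\<Sum>k. ennreal (cascade_length w (truncation i k) \<omega>))"
    by (intro sum_le_suminf) auto
  also have "\<dots> \<le> cascade_height S w \<omega>"
    unfolding cascade_height_def by (rule SUP_upper[OF i])
  finally show ?thesis .
qed

lemma cascade_height_ge_1: "1 \<le> cascade_height S w \<omega>"
  using cascade_height_ge[of "[]" 1 \<omega>] by (simp add: cascade_length_def)

lemma measurable_tuple:
  "v \<in> lists S \<Longrightarrow> (\<lambda>\<omega>. \<lambda>j\<in>S. w (v @ [j]) \<omega>) \<in> measurable M (Pi\<^sub>M S (\<lambda>j. borel))"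
  using indep_tuples unfolding indep_vars_def by auto

lemma nn_integral_tuple_eq:
  assumes v: "v \<in> lists S" and f: "f \<in> borel_measurable (Pi\<^sub>M S (\<lambda>j. borel))"
  shows "(\<integral>\<^sup>+\<omega>. f (\<lambda>j\<in>S. w (v @ [j]) \<omega>) \<partial>M) = (\<integral>\<^sup>+\<omega>. f (\<lambda>j\<in>S. w [j] \<omega>) \<partial>M)"
  using nn_integral_distr[OF measurable_tuple[OF v], of f]
    nn_integral_distr[OF measurable_tuple[of "[]"], of f] identically_distributed[OF v] f
  by simp

subsection \<open>Moments of the height\<close>

text \<open>The weights along \<open>u\<close> belong to tuples at distinct parents, so they are
  independent although weights of siblings may not be; each has the law of the corresponding
  first-level weight.\<close>

lemma nn_integral_cascade_length_power:
  assumes u: "u \<in> lists S"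
  shows "(\<integral>\<^sup>+\<omega>. ennreal (cascade_length w u \<omega> ^ p) \<partial>M) =
    prod_list (map (\<lambda>j. \<integral>\<^sup>+\<omega>. ennreal (w [j] \<omega> ^ p) \<partial>M) u)"
proof -
  \<comment> \<open>\<open>I\<close> is the set of parents, the proper prefixes of \<open>u\<close>.
    A parent is recovered from its length, so \<open>X\<close> can be indexed by parents, with
    \<open>u ! length v\<close> as the next letter.\<close>
  define I where "I = (\<lambda>k. take k u) ` {..<length u}"
  define X where "X v \<omega> = ennreal (w (v @ [u ! length v]) \<omega> ^ p)" for v \<omega>
  have inj: "inj_on (\<lambda>k. take k u) {..<length u}"
    by (rule inj_on_inverseI[where g=length]) auto
  have IS: "I \<subseteq> lists S" using u by (auto simp: I_def dest: in_set_takeD)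
  have uS: "u ! k \<in> S" if "k < length u" for k using u that by (auto simp: in_lists_conv_set)
  have I: "length v < length u" if "v \<in> I" for v using that by (auto simp: I_def)
  have "indep_vars (\<lambda>_. borel) (\<lambda>v \<omega>. ennreal ((\<lambda>j\<in>S. w (v @ [j]) \<omega>) (u ! length v) ^ p)) I"
    by (rule indep_vars_compose2[OF indep_vars_subset[OF indep_tuples IS],
        where Y="\<lambda>v x. ennreal (x (u ! length v) ^ p)"])
      (use uS I in \<open>auto intro!: measurable_compose[OF _ measurable_ennreal] borel_measurable_power
        measurable_component_singleton\<close>)
  also have "?this \<longleftrightarrow> indep_vars (\<lambda>_. borel) X I"
    using uS I by (intro indep_vars_cong) (auto simp: X_def fun_eq_iff)
  finally have indep: "indep_vars (\<lambda>_. borel) X I" .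
  have ilen: "cascade_length w u \<omega> = (\<Prod>k<length u. w (take k u @ [u ! k]) \<omega>)" for \<omega>
    unfolding cascade_length_def
    by (rule prod.reindex_bij_witness[where i=Suc and j="\<lambda>k. k - 1"])
      (auto simp: take_Suc_conv_app_nth[symmetric])
  have "ennreal (cascade_length w u \<omega> ^ p) = (\<Prod>v\<in>I. X v \<omega>)" if "\<omega> \<in> space M" for \<omega>
  proof -
    have "0 \<le> w (take k u @ [u ! k]) \<omega> ^ p" if "k < length u" for k
      using w_bounds(1)[OF _ uS[OF that] \<open>\<omega> \<in> _\<close>, of "take k u"] u
      by (intro zero_le_power) (auto dest: in_set_takeD)
    then show ?thesis
      unfolding I_def ilen prod_power_distrib prod.reindex[OF inj]
      by (auto simp: X_def intro!: prod_ennreal[symmetric])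
  qed
  then have "(\<integral>\<^sup>+\<omega>. ennreal (cascade_length w u \<omega> ^ p) \<partial>M) = (\<integral>\<^sup>+\<omega>. (\<Prod>v\<in>I. X v \<omega>) \<partial>M)"
    by (intro nn_integral_cong) auto
  also have "\<dots> = (\<Prod>v\<in>I. \<integral>\<^sup>+\<omega>. X v \<omega> \<partial>M)"
    by (rule indep_vars_nn_integral) (auto simp: I_def indep[unfolded I_def])
  also have "\<dots> = (\<Prod>v\<in>I. \<integral>\<^sup>+\<omega>. ennreal (w [u ! length v] \<omega> ^ p) \<partial>M)"
  proof (intro prod.cong refl)
    fix v assume v: "v \<in> I"
    have "(\<lambda>x. ennreal (x (u ! length v) ^ p)) \<in> borel_measurable (Pi\<^sub>M S (\<lambda>j. borel))"
      using uS I[OF v] by (auto intro!: measurable_compose[OF _ measurable_ennreal]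
        borel_measurable_power measurable_component_singleton)
    from nn_integral_tuple_eq[OF _ this, of v]
    show "(\<integral>\<^sup>+\<omega>. X v \<omega> \<partial>M) = (\<integral>\<^sup>+\<omega>. ennreal (w [u ! length v] \<omega> ^ p) \<partial>M)"
      using v IS uS I[OF v] by (auto simp: X_def)
  qed
  also have "\<dots> = (\<Prod>k<length u. \<integral>\<^sup>+\<omega>. ennreal (w [u ! k] \<omega> ^ p) \<partial>M)"
    unfolding I_def prod.reindex[OF inj] by simp
  also have "\<dots> = prod_list (map (\<lambda>j. \<integral>\<^sup>+\<omega>. ennreal (w [j] \<omega> ^ p) \<partial>M) u)"
    by (simp add: prod.list_conv_set_nth atLeast0LessThan)
  finally show ?thesis .
qed

text \<open>As \<open>p\<close> grows, \<open>x ^ p\<close> tends to \<open>0\<close> for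
  \<open>0 \<le> x < 1\<close> and stays \<open>1\<close> at \<open>x = 1\<close>; dominated
  convergence does the rest. This is how the probabilities of unit weights enter case (a).\<close>

lemma moments_tendsto:
  assumes j: "j \<in> S"
  shows "(\<lambda>p. \<integral>\<omega>. w [j] \<omega> ^ p \<partial>M) \<longlonglongrightarrow> \<P>(\<omega> in M. w [j] \<omega> = 1)"
proof -
  have [measurable]: "w [j] \<in> borel_measurable M" using measurable_w[of "[]" j] j by simp
  have b: "0 \<le> w [j] \<omega>" "w [j] \<omega> \<le> 1" if "\<omega> \<in> space M" for \<omega>
    using w_bounds[of "[]" j \<omega>] j that by auto
  let ?A = "{\<omega> \<in> space M. w [j] \<omega> = 1}"
  have "(\<lambda>p. \<integral>\<omega>. w [j] \<omega> ^ p \<partial>M) \<longlonglongrightarrow> (\<integral>\<omega>. indicator ?A \<omega> \<partial>M)"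
  proof (rule integral_dominated_convergence[where w="\<lambda>_. 1"])
    show "AE \<omega> in M. (\<lambda>p. w [j] \<omega> ^ p) \<longlonglongrightarrow> indicator ?A \<omega>"
    proof (rule AE_I2)
      fix \<omega> assume "\<omega> \<in> space M"
      then show "(\<lambda>p. w [j] \<omega> ^ p) \<longlonglongrightarrow> indicator ?A \<omega>"
        using b[of \<omega>] by (cases "w [j] \<omega> = 1") (auto intro!: LIMSEQ_power_zero)
    qed
    show "AE \<omega> in M. norm (w [j] \<omega> ^ p) \<le> 1" for p
      by (rule AE_I2) (use b in \<open>auto simp: power_le_one\<close>)
  qed auto
  then show ?thesis by simp
qed

text \<open>Each single term of the series is at most \<open>y\<close>, so after taking p-th roots
  the lengths at level \<open>n\<close> are bounded by \<open>\<theta> ^ n * root p y\<close>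
  uniformly over words. Every path is then dominated by the same geometric series.\<close>

lemma cascade_height_power_le:
  fixes r :: real
  assumes r: "0 < r" "r < 1" and p: "p > 0" and \<omega>: "\<omega> \<in> space M"
    and Y: "ennreal y = (\<Sum>n. \<Sum>u | set u \<subseteq> S \<and> length u = n. ennreal (cascade_length w u \<omega> ^ p / r ^ n))"
    and y: "0 \<le> y"
  shows "\<exists>h\<ge>0. cascade_height S w \<omega> = ennreal h \<and> h ^ p \<le> y / (1 - root p r) ^ p"
proof -
  define \<theta> where "\<theta> = root p r"
  have \<theta>: "0 < \<theta>" "\<theta> < 1" using r p by (auto simp: \<theta>_def)
  have l: "cascade_length w u \<omega> \<le> \<theta> ^ length u * root p y" if u: "u \<in> lists S" for u
  proof -
    let ?f = "\<lambda>n. \<Sum>u | set u \<subseteq> S \<and> length u = n. ennreal (cascade_length w u \<omega> ^ p / r ^ n)"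
    have "ennreal (cascade_length w u \<omega> ^ p / r ^ length u) \<le> ?f (length u)"
      by (rule member_le_sum) (use u in \<open>auto intro!: finite_lists_length_eq finite_S\<close>)
    also have "\<dots> \<le> ennreal y" unfolding Y using sum_le_suminf[of ?f "{length u}"] by simp
    finally have "cascade_length w u \<omega> ^ p \<le> r ^ length u * y"
      using y r by (simp add: field_simps)
    then have "root p (cascade_length w u \<omega> ^ p) \<le> root p (r ^ length u * y)"
      using p by simp
    then show ?thesis
      using p cascade_length_nonneg[OF u \<omega>]
      by (simp add: real_root_power_cancel real_root_mult real_root_power \<theta>_def)
  qed
  have "cascade_height S w \<omega> \<le> ennreal (root p y / (1 - \<theta>))"
    unfolding cascade_height_def
  proof (rule SUP_least)
    fix i :: "nat \<Rightarrow> 's" assume "i \<in> UNIV \<rightarrow> S"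
    then have t: "truncation i n \<in> lists S" for n by (auto simp: truncation_def Pi_iff)
    have len: "length (truncation i n) = n" for n by (simp add: truncation_def)
    have "(\<Sum>n. ennreal (cascade_length w (truncation i n) \<omega>)) \<le> (\<Sum>n. ennreal (\<theta> ^ n * root p y))"
      using l[OF t] by (intro suminf_le ennreal_leI) (auto simp: len)
    also have "\<dots> = ennreal (1 / (1 - \<theta>) * root p y)"
      using \<theta> y p by (intro suminf_ennreal_eq sums_mult2 geometric_sums) auto
    finally show "(\<Sum>n. ennreal (cascade_length w (truncation i n) \<omega>)) \<le> ennreal (root p y / (1 - \<theta>))"
      by simp
  qed
  moreover then obtain h where h: "h \<ge> 0" "cascade_height S w \<omega> = ennreal h"
    by (cases "cascade_height S w \<omega>") (auto simp: top_unique)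
  ultimately have "h \<le> root p y / (1 - \<theta>)" using \<theta> y p by simp
  then have "h ^ p \<le> (root p y / (1 - \<theta>)) ^ p" using h by (intro power_mono)
  then have "h ^ p \<le> y / (1 - root p r) ^ p" using y p by (simp add: power_divide \<theta>_def)
  then show ?thesis using h by blast
qed

theorem subcritical_moments_finite:
  assumes sub: "(\<Sum>j\<in>S. \<P>(\<omega> in M. w [j] \<omega> = 1)) < 1"
  shows "(\<integral>\<^sup>+\<omega>. ennreal_powr (cascade_height S w \<omega>) d \<partial>M) < \<infinity>"
proof (cases "d > 0")
  \<comment> \<open>For \<open>d \<le> 0\<close> the bound \<open>H \<ge> 1\<close> already gives
    \<open>H\<^sup>d \<le> 1\<close>.\<close>
  case False
  have "ennreal_powr (cascade_height S w \<omega>) d \<le> 1" for \<omega>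
  proof (cases "cascade_height S w \<omega>")
    case (real h)
    then have "1 \<le> h" using cascade_height_ge_1[of \<omega>] by (metis ennreal_1 ennreal_le_iff)
    then have "h powr d \<le> 1" using False powr_mono[of d 0 h] by simp
    then show ?thesis using real \<open>1 \<le> h\<close> False
      by (auto simp: ennreal_powr_def ennreal_le_1)
  qed (use False in \<open>auto simp: ennreal_powr_def\<close>)
  then have "(\<integral>\<^sup>+\<omega>. ennreal_powr (cascade_height S w \<omega>) d \<partial>M) \<le> (\<integral>\<^sup>+\<omega>. 1 \<partial>M)"
    by (intro nn_integral_mono)
  then show ?thesis by (simp add: emeasure_space_1 le_less_trans)
next
  case True
  let ?m = "\<lambda>p. \<Sum>j\<in>S. \<integral>\<omega>. w [j] \<omega> ^ p \<partial>M"
  have "?m \<longlonglongrightarrow> (\<Sum>j\<in>S. \<P>(\<omega> in M. w [j] \<omega> = 1))"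
    by (intro tendsto_sum moments_tendsto)
  then have 1: "\<forall>\<^sub>F p in sequentially. ?m p < 1" using sub by (rule order_tendstoD)
  have 2: "\<forall>\<^sub>F p in sequentially. d \<le> real p" by (rule eventually_at_top_linorderI[of "nat \<lceil>d\<rceil>"]) linarith
  \<comment> \<open>A natural exponent above \<open>d\<close> suffices: since
    \<open>H \<ge> 1\<close>, the moment of order \<open>p\<close> dominates that of order
    \<open>d\<close>.\<close>
  obtain p where p: "?m p < 1" "d \<le> real p"
    using eventually_happens'[OF sequentially_bot eventually_conj[OF 1 2]] by auto
  have p0: "p > 0" using p(2) True by (cases p) auto
  have wj [measurable]: "w [j] \<in> borel_measurable M" if "j \<in> S" for j
    using measurable_w[of "[]" j] that by simp
  have b: "0 \<le> w [j] \<omega>" "w [j] \<omega> \<le> 1" if "\<omega> \<in> space M" "j \<in> S" for j \<omega>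
    using w_bounds[of "[]" j \<omega>] that by auto
  have nonneg: "0 \<le> (\<integral>\<omega>. w [j] \<omega> ^ p \<partial>M)" if "j \<in> S" for j
    using b that by (intro integral_nonneg_AE AE_I2) auto
  have a: "(\<integral>\<^sup>+\<omega>. ennreal (w [j] \<omega> ^ p) \<partial>M) = ennreal (\<integral>\<omega>. w [j] \<omega> ^ p \<partial>M)" if "j \<in> S" for j
  proof (rule nn_integral_eq_integral)
    show "integrable M (\<lambda>\<omega>. w [j] \<omega> ^ p)"
      by (rule integrable_const_bound[of _ 1])
        (use b that wj in \<open>auto intro!: AE_I2 simp: power_le_one\<close>)
    show "AE \<omega> in M. 0 \<le> w [j] \<omega> ^ p" using b that by (intro AE_I2) auto
  qed
  have m0: "0 \<le> ?m p" by (intro sum_nonneg nonneg)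
  \<comment> \<open>The midpoint lies strictly between \<open>?m p\<close> and \<open>1\<close> and
    is positive even if all moments vanish. \<open>?m p < r\<close> makes the series for
    \<open>E Y\<close> converge, \<open>r < 1\<close> the series along each path.\<close>
  define r where "r = (?m p + 1) / 2"
  have r: "0 < r" "r < 1" "?m p < r" using p(1) m0 by (auto simp: r_def)
  define Y where "Y \<omega> = (\<Sum>n. \<Sum>u | set u \<subseteq> S \<and> length u = n. ennreal (cascade_length w u \<omega> ^ p / r ^ n))" for \<omega>
  define c where "c = 1 / (1 - root p r) ^ p"
  have c: "c > 0" using r p0 by (simp add: c_def)
  have meas: "(\<lambda>\<omega>. ennreal (cascade_length w u \<omega> ^ p)) \<in> borel_measurable M" if "set u \<subseteq> S" for u
    using measurable_cascade_length[of u] that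
    by (auto intro!: measurable_compose[OF _ measurable_ennreal] borel_measurable_power)
  have Yeq: "Y \<omega> = (\<Sum>n. \<Sum>u | set u \<subseteq> S \<and> length u = n. ennreal (1 / r ^ n) * ennreal (cascade_length w u \<omega> ^ p))" if "\<omega> \<in> space M" for \<omega>
    unfolding Y_def using cascade_length_nonneg r that
    by (intro suminf_cong sum.cong) (auto simp: ennreal_mult[symmetric] in_lists_conv_set subset_iff)
  have "(\<integral>\<^sup>+\<omega>. Y \<omega> \<partial>M) = (\<integral>\<^sup>+\<omega>. (\<Sum>n. \<Sum>u | set u \<subseteq> S \<and> length u = n. ennreal (1 / r ^ n) * ennreal (cascade_length w u \<omega> ^ p)) \<partial>M)"
    by (intro nn_integral_cong Yeq)
  also have "\<dots> = (\<Sum>n. \<Sum>u | set u \<subseteq> S \<and> length u = n. ennreal (1 / r ^ n) * (\<integral>\<^sup>+\<omega>. ennreal (cascade_length w u \<omega> ^ p) \<partial>M))"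
  proof -
    have m: "(\<lambda>\<omega>. ennreal (1 / r ^ n) * ennreal (cascade_length w u \<omega> ^ p)) \<in> borel_measurable M"
      if "u \<in> {u. set u \<subseteq> S \<and> length u = n}" for u n
      using that by (intro borel_measurable_times_ennreal meas) auto
    show ?thesis
    proof (subst nn_integral_suminf)
      show "(\<lambda>\<omega>. \<Sum>u | set u \<subseteq> S \<and> length u = n. ennreal (1 / r ^ n) * ennreal (cascade_length w u \<omega> ^ p))
          \<in> borel_measurable M" for n
        by (intro borel_measurable_sum m)
      show "(\<Sum>n. \<integral>\<^sup>+\<omega>. (\<Sum>u | set u \<subseteq> S \<and> length u = n. ennreal (1 / r ^ n) * ennreal (cascade_length w u \<omega> ^ p)) \<partial>M) =
          (\<Sum>n. \<Sum>u | set u \<subseteq> S \<and> length u = n. ennreal (1 / r ^ n) * (\<integral>\<^sup>+\<omega>. ennreal (cascade_length w u \<omega> ^ p) \<partial>M))"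
        by (intro suminf_cong, subst nn_integral_sum[OF m], assumption)
          (auto intro!: sum.cong nn_integral_cmult meas)
    qed
  qed
  also have "\<dots> = (\<Sum>n. ennreal (1 / r ^ n) * (\<Sum>u | set u \<subseteq> S \<and> length u = n. prod_list (map (\<lambda>j. ennreal (\<integral>\<omega>. w [j] \<omega> ^ p \<partial>M)) u)))"
  proof -
    have "(\<integral>\<^sup>+\<omega>. ennreal (cascade_length w u \<omega> ^ p) \<partial>M) = prod_list (map (\<lambda>j. ennreal (\<integral>\<omega>. w [j] \<omega> ^ p \<partial>M)) u)" if "set u \<subseteq> S" for u
    proof -
      have eq: "map (\<lambda>j. \<integral>\<^sup>+\<omega>. ennreal (w [j] \<omega> ^ p) \<partial>M) u = map (\<lambda>j. ennreal (\<integral>\<omega>. w [j] \<omega> ^ p \<partial>M)) u"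
        using that a by auto
      show ?thesis
        using nn_integral_cascade_length_power[of u p] that
        unfolding eq by (simp add: in_lists_conv_set subset_iff)
    qed
    then show ?thesis
      unfolding sum_distrib_left by (intro arg_cong[where f=suminf] ext sum.cong) auto
  qed
  also have "\<dots> = (\<Sum>n. ennreal ((?m p / r) ^ n))"
  proof -
    have "(\<Sum>j\<in>S. ennreal (\<integral>\<omega>. w [j] \<omega> ^ p \<partial>M)) = ennreal (?m p)"
      using nonneg by (rule sum_ennreal)
    moreover have "ennreal (1 / r ^ n) * ennreal (?m p) ^ n = ennreal ((?m p / r) ^ n)" for n
      using m0 r
      by (simp add: ennreal_power ennreal_mult[symmetric] power_divide del: power_one_over sum_ennreal)
    ultimately show ?thesis unfolding sum_prod_list_words by (simp only:)
  qed
  also have "\<dots> < \<infinity>"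
  proof -
    have "0 \<le> ?m p / r" "?m p / r < 1" using m0 r by (auto simp: field_simps)
    then have "(\<Sum>n. ennreal ((?m p / r) ^ n)) \<noteq> top"
      by (intro ennreal_suminf_neq_top summable_geometric zero_le_power) simp_all
    then show ?thesis by (simp only: infinity_ennreal_def top.not_eq_extremum)
  qed
  finally have EY: "(\<integral>\<^sup>+\<omega>. Y \<omega> \<partial>M) < \<infinity>" .
  \<comment> \<open>Where \<open>Y\<close> is finite,
    \<open>H\<^sup>d \<le> H\<^sup>p \<le> c Y\<close>; where it is infinite, the right side is
    infinite because \<open>c > 0\<close>.\<close>
  have le: "ennreal_powr (cascade_height S w \<omega>) d \<le> ennreal c * Y \<omega>" if \<omega>: "\<omega> \<in> space M" for \<omega>
  proof (cases "Y \<omega>")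
    case (real y)
    from cascade_height_power_le[OF r(1,2) p0 \<omega> real(2)[symmetric, unfolded Y_def] real(1)]
    obtain h where h: "h \<ge> 0" "cascade_height S w \<omega> = ennreal h" "h ^ p \<le> c * y"
      by (auto simp: c_def)
    have "1 \<le> h" using cascade_height_ge_1[of \<omega>] h by (metis ennreal_1 ennreal_le_iff)
    then have "h powr d \<le> h ^ p" using p(2) powr_mono[of d "real p" h] by (simp add: powr_realpow)
    then show ?thesis
      using h real True c \<open>1 \<le> h\<close>
      by (auto simp: ennreal_powr_def ennreal_mult[symmetric])
  qed (use c in \<open>auto simp: ennreal_mult_top\<close>)
  have "(\<integral>\<^sup>+\<omega>. ennreal_powr (cascade_height S w \<omega>) d \<partial>M) \<le> (\<integral>\<^sup>+\<omega>. ennreal c * Y \<omega> \<partial>M)"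
    by (intro nn_integral_mono le)
  also have "\<dots> = ennreal c * (\<integral>\<^sup>+\<omega>. Y \<omega> \<partial>M)"
  proof (rule nn_integral_cmult)
    show "Y \<in> borel_measurable M"
      by (subst measurable_cong[OF Yeq])
        (auto intro!: borel_measurable_suminf_order borel_measurable_sum borel_measurable_times_ennreal meas)
  qed
  also have "\<dots> < \<infinity>" using EY by (simp add: ennreal_mult_less_top)
  finally show ?thesis .
qed

subsection \<open>The tree of unit weights\<close>

text \<open>Survival of the unit-weight tree rooted at \<open>v\<close> for \<open>n\<close>
  generations. The recursion splits off the first generation, so that the subtrees of the children
  appear directly.\<close>

primrec unit_path :: "nat \<Rightarrow> 's list \<Rightarrow> 'w set" where
  "unit_path 0 v = space M"
| "unit_path (Suc n) v = (\<Union>j\<in>S. {\<omega> \<in> space M. w (v @ [j]) \<omega> = 1} \<inter> unit_path n (v @ [j]))"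

text \<open>The sigma-algebra generated by the tuple at \<open>v\<close>, written as preimages
  because independence of random variables is characterised by independence of these
  families.\<close>

definition tuple_events :: "'s list \<Rightarrow> 'w set set" where
  "tuple_events v = {(\<lambda>\<omega>. \<lambda>j\<in>S. w (v @ [j]) \<omega>) -` B \<inter> space M | B. B \<in> sets (Pi\<^sub>M S (\<lambda>j. borel))}"

lemma unit_path_sub_space: "unit_path n v \<subseteq> space M"
  by (cases n) auto

lemma unit_path_antimono: "unit_path (Suc n) v \<subseteq> unit_path n v"
proof (induction n arbitrary: v)
  case (Suc n)
  show ?case
    unfolding unit_path.simps(2)[of "Suc n" v] unit_path.simps(2)[of n v]
    by (intro UN_mono Int_mono Suc order_refl)
qed (use unit_path_sub_space in auto)

lemma unit_path_witness:
  assumes "\<omega> \<in> unit_path n v"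
  shows "\<exists>u\<in>lists S. length u = n \<and> (\<forall>k\<in>{1..n}. w (v @ take k u) \<omega> = 1)"
  using assms
proof (induction n arbitrary: v)
  case 0
  then show ?case by (intro bexI[of _ "[]"]) auto
next
  case (Suc n)
  then obtain j where j: "j \<in> S" "w (v @ [j]) \<omega> = 1" "\<omega> \<in> unit_path n (v @ [j])" by auto
  from Suc.IH[OF j(3)] obtain u where u: "u \<in> lists S" "length u = n"
    and w: "\<forall>k\<in>{1..n}. w ((v @ [j]) @ take k u) \<omega> = 1" by blast
  have "w (v @ take k (j # u)) \<omega> = 1" if k1: "k \<in> {1..Suc n}" for k
  proof (cases "k = 1")
    case False
    then obtain l where k: "k = Suc l" using k1 by (cases k) auto
    then have "l \<in> {1..n}" using k1 False by auto
    from bspec[OF w this] show ?thesis by (simp add: k)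
  qed (use j(2) in simp)
  then show ?case using u j(1) by (intro bexI[of _ "j # u"]) auto
qed

text \<open>All prefixes of the witnessing path have length value \<open>1\<close>; counting the
  empty word there are \<open>n + 1\<close> of them.\<close>

lemma cascade_height_unit_path:
  assumes "\<omega> \<in> unit_path n []"
  shows "of_nat (Suc n) \<le> cascade_height S w \<omega>"
proof -
  from unit_path_witness[OF assms] obtain u where u: "u \<in> lists S" "length u = n"
    and w: "\<forall>k\<in>{1..n}. w (take k u) \<omega> = 1" by fastforce
  have "cascade_length w (take k u) \<omega> = 1" if "k < Suc n" for k
    unfolding cascade_length_def using that u(2) w
    by (intro prod.neutral) (auto simp: min_def)
  then show ?thesis using cascade_height_ge[OF u(1), of "Suc n" \<omega>] u(2) by simp
qed

lemma unit_weight_event: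
  assumes "j \<in> S"
  shows "{\<omega> \<in> space M. w (v @ [j]) \<omega> = 1} \<in> tuple_events v"
proof -
  have "{x \<in> space (Pi\<^sub>M S (\<lambda>j. borel)). x j = (1::real)} \<in> sets (Pi\<^sub>M S (\<lambda>j. borel))"
    using assms by measurable
  moreover have "{\<omega> \<in> space M. w (v @ [j]) \<omega> = 1} = (\<lambda>\<omega>. \<lambda>j\<in>S. w (v @ [j]) \<omega>) -`
      {x \<in> space (Pi\<^sub>M S (\<lambda>j. borel)). x j = (1::real)} \<inter> space M"
    using assms by (auto simp: space_PiM)
  ultimately show ?thesis unfolding tuple_events_def by blast
qed

text \<open>Survival below \<open>v\<close> is determined by the tuples at \<open>v\<close> and its
  descendants. Subtrees of different children therefore involve disjoint sets of tuples.\<close>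

lemma unit_path_in_sigma:
  assumes "v \<in> lists S"
  shows "unit_path n v \<in> sigma_sets (space M) (\<Union>x\<in>{v @ u | u. u \<in> lists S}. tuple_events x)"
  using assms
proof (induction n arbitrary: v)
  case 0
  then show ?case by (simp add: sigma_sets_top)
next
  case (Suc n)
  let ?G = "\<lambda>v. \<Union>x\<in>{v @ u | u. u \<in> lists S}. tuple_events x"
  have "?G v \<subseteq> Pow (space M)" by (auto simp: tuple_events_def)
  then interpret G: sigma_algebra "space M" "sigma_sets (space M) (?G v)"
    by (rule sigma_algebra_sigma_sets)
  have "{\<omega> \<in> space M. w (v @ [j]) \<omega> = 1} \<inter> unit_path n (v @ [j]) \<in> sigma_sets (space M) (?G v)"
    if j: "j \<in> S" for j
  proof (rule G.Int)
    show "{\<omega> \<in> space M. w (v @ [j]) \<omega> = 1} \<in> sigma_sets (space M) (?G v)"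
      using unit_weight_event[OF j, of v] by (intro sigma_sets.Basic UN_I[of v]) auto
    have "?G (v @ [j]) \<subseteq> ?G v"
    proof (rule UN_mono)
      show "{(v @ [j]) @ u |u. u \<in> lists S} \<subseteq> {v @ u |u. u \<in> lists S}"
        using j by auto
    qed simp
    moreover have "unit_path n (v @ [j]) \<in> sigma_sets (space M) (?G (v @ [j]))"
      using Suc.IH[of "v @ [j]"] Suc.prems j by simp
    ultimately show "unit_path n (v @ [j]) \<in> sigma_sets (space M) (?G v)"
      using sigma_sets_mono' by blast
  qed
  then show ?case unfolding unit_path.simps
    by (intro G.finite_UN finite_S) auto
qed

section \<open>Independence of subtrees and the die-out recursion\<close>

text \<open>The random set is kept rather than its size: siblings may be dependent, but once the set
  is fixed, it is known which subtrees have to die out.\<close>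

definition unit_children :: "'s list \<Rightarrow> 'w \<Rightarrow> 's set" where
  "unit_children v \<omega> = {j \<in> S. w (v @ [j]) \<omega> = 1}"

text \<open>One and the same \<open>B\<close> serves all \<open>v\<close>; this uniformity transfers
  the equality of the laws of the tuples to the sets of children.\<close>

lemma unit_children_tuple:
  "\<exists>B\<in>sets (Pi\<^sub>M S (\<lambda>j. borel)). \<forall>v. {\<omega> \<in> space M. unit_children v \<omega> = J} =
    (\<lambda>\<omega>. \<lambda>j\<in>S. w (v @ [j]) \<omega>) -` B \<inter> space M"
proof (intro bexI allI)
  let ?B = "{x \<in> space (Pi\<^sub>M S (\<lambda>j. borel)). {j\<in>S. x j = (1::real)} = J}"
  show "{\<omega> \<in> space M. unit_children v \<omega> = J} = (\<lambda>\<omega>. \<lambda>j\<in>S. w (v @ [j]) \<omega>) -` ?B \<inter> space M" for v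
    by (auto simp: space_PiM unit_children_def)
  have "?B = (if J \<subseteq> S then {x \<in> space (Pi\<^sub>M S (\<lambda>j. borel)). \<forall>j\<in>S. x j = (1::real) \<longleftrightarrow> j \<in> J} else {})"
    by auto
  also have "\<dots> \<in> sets (Pi\<^sub>M S (\<lambda>j. borel))"
    using finite_S by (auto intro!: sets.sets_Collect_finite_All pred_intros_logic)
  finally show "?B \<in> sets (Pi\<^sub>M S (\<lambda>j. borel))" .
qed

lemma prob_unit_children:
  assumes "v \<in> lists S"
  shows "\<P>(\<omega> in M. unit_children v \<omega> = J) = \<P>(\<omega> in M. unit_children [] \<omega> = J)"
proof -
  from unit_children_tuple[of J] obtain B where B: "B \<in> sets (Pi\<^sub>M S (\<lambda>j. borel))"
    and eq: "\<And>v. {\<omega> \<in> space M. unit_children v \<omega> = J} = (\<lambda>\<omega>. \<lambda>j\<in>S. w (v @ [j]) \<omega>) -` B \<inter> space M"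
    by blast
  have "\<P>(\<omega> in M. unit_children u \<omega> = J) =
      measure (distr M (Pi\<^sub>M S (\<lambda>j. borel)) (\<lambda>\<omega>. \<lambda>j\<in>S. w (u @ [j]) \<omega>)) B" if "u \<in> lists S" for u
    unfolding eq using measure_distr[OF measurable_tuple[OF that] B] by simp
  from this[OF assms] this[of "[]"] show ?thesis
    by (simp add: identically_distributed[OF assms])
qed

lemma unit_path_events: "v \<in> lists S \<Longrightarrow> unit_path n v \<in> events"
proof (induction n arbitrary: v)
  case (Suc n)
  have "{\<omega> \<in> space M. w (v @ [j]) \<omega> = 1} \<in> events" if "j \<in> S" for j
    using measurable_w[OF Suc.prems that] by measurable
  moreover have "unit_path n (v @ [j]) \<in> events" if "j \<in> S" for j
    using that Suc.prems by (intro Suc.IH) auto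
  ultimately show ?case unfolding unit_path.simps
    using finite_S by (intro sets.finite_UN sets.Int) auto
qed simp

lemma unit_children_events: "v \<in> lists S \<Longrightarrow> {\<omega> \<in> space M. unit_children v \<omega> = J} \<in> events"
  using unit_children_tuple[of J] by (auto intro: measurable_sets[OF measurable_tuple])

text \<open>The set of children depends on the tuple at \<open>v\<close> alone, and the fate of each
  child on the tuples in its own subtree. These blocks of words are disjoint, so the events are
  independent.\<close>

lemma prob_children_die_out:
  assumes v: "v \<in> lists S" and J: "J \<subseteq> S"
  shows "prob ({\<omega> \<in> space M. unit_children v \<omega> = J} \<inter> (\<Inter>j\<in>J. space M - unit_path n (v @ [j]))) =
    \<P>(\<omega> in M. unit_children v \<omega> = J) * (\<Prod>j\<in>J. prob (space M - unit_path n (v @ [j])))"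
proof -
  \<comment> \<open>\<open>K\<close> lists the blocks: \<open>None\<close> stands for the root
    \<open>v\<close>, \<open>Some j\<close> for the subtree of its child \<open>j\<close>.
    \<open>A\<close> assigns to each block its event.\<close>
  define K where "K = case_option {v} (\<lambda>j. {(v @ [j]) @ u | u. u \<in> lists S})"
  define A where "A = case_option {\<omega> \<in> space M. unit_children v \<omega> = J} (\<lambda>j. space M - unit_path n (v @ [j]))"
  let ?I = "insert None (Some ` J)"
  have "indep_sets tuple_events (lists S)"
    using indep_tuples unfolding indep_vars_def2 tuple_events_def[abs_def] by blast
  moreover have "(\<Union>i\<in>?I. K i) \<subseteq> lists S" using v J by (auto simp: K_def)
  ultimately have "indep_sets tuple_events (\<Union>i\<in>?I. K i)" by (rule indep_sets_mono_index[rotated])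
  \<comment> \<open>Closure under intersection is what allows independence to pass from the families
    to the sigma-algebras generated by whole blocks.\<close>
  moreover have "Int_stable (tuple_events x)" for x
    unfolding Int_stable_def tuple_events_def
  proof safe
    fix B B' assume "B \<in> sets (Pi\<^sub>M S (\<lambda>j. borel :: real measure))" "B' \<in> sets (Pi\<^sub>M S (\<lambda>j. borel :: real measure))"
    then show "\<exists>B''. ((\<lambda>\<omega>. \<lambda>j\<in>S. w (x @ [j]) \<omega>) -` B \<inter> space M) \<inter> ((\<lambda>\<omega>. \<lambda>j\<in>S. w (x @ [j]) \<omega>) -` B' \<inter> space M) =
        (\<lambda>\<omega>. \<lambda>j\<in>S. w (x @ [j]) \<omega>) -` B'' \<inter> space M \<and> B'' \<in> sets (Pi\<^sub>M S (\<lambda>j. borel))"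
      by (intro exI[of _ "B \<inter> B'"]) auto
  qed
  moreover have "disjoint_family_on K ?I"
    by (auto simp: disjoint_family_on_def K_def)
  ultimately have ind: "indep_sets (\<lambda>i. sigma_sets (space M) (\<Union>x\<in>K i. tuple_events x)) ?I"
    by (rule indep_sets_collect_sigma)
  have "A i \<in> sigma_sets (space M) (\<Union>x\<in>K i. tuple_events x)" if "i \<in> ?I" for i
  proof (cases i)
    case None
    have "{\<omega> \<in> space M. unit_children v \<omega> = J} \<in> tuple_events v"
      using unit_children_tuple[of J] unfolding tuple_events_def by blast
    then show ?thesis using None by (simp add: A_def K_def sigma_sets.Basic)
  next
    case (Some j)
    then have "j \<in> S" using that J by auto
    then have "unit_path n (v @ [j]) \<in> sigma_sets (space M) (\<Union>x\<in>K i. tuple_events x)"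
      using unit_path_in_sigma[of "v @ [j]" n] v Some by (simp add: K_def)
    then show ?thesis using Some by (auto simp: A_def intro: sigma_sets.Compl)
  qed
  then have "prob (\<Inter>i\<in>?I. A i) = (\<Prod>i\<in>?I. prob (A i))"
    using finite_subset[OF J finite_S] by (intro indep_setsD[OF ind]) auto
  also have "(\<Inter>i\<in>?I. A i) =
      {\<omega> \<in> space M. unit_children v \<omega> = J} \<inter> (\<Inter>j\<in>J. space M - unit_path n (v @ [j]))"
    by (simp only: INT_insert image_image INT_simps A_def option.case)
  also have "(\<Prod>i\<in>?I. prob (A i)) = prob (A None) * (\<Prod>i\<in>Some ` J. prob (A i))"
    using finite_subset[OF J finite_S] by (intro prod.insert) auto
  also have "(\<Prod>i\<in>Some ` J. prob (A i)) = (\<Prod>j\<in>J. prob (A (Some j)))"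
    by (subst prod.reindex) (auto simp: o_def)
  finally show ?thesis by (simp only: A_def option.case)
qed

text \<open>Partition by the set \<open>J\<close> of unit children: the tree misses generation
  \<open>n + 1\<close> exactly if the subtree of every child in \<open>J\<close> misses generation
  \<open>n\<close>. The empty \<open>J\<close> contributes the empty product.\<close>

lemma prob_die_out_Suc:
  assumes v: "v \<in> lists S"
  shows "prob (space M - unit_path (Suc n) v) =
    (\<Sum>J\<in>Pow S. \<P>(\<omega> in M. unit_children [] \<omega> = J) * (\<Prod>j\<in>J. prob (space M - unit_path n (v @ [j]))))"
proof -
  define D where "D J = {\<omega> \<in> space M. unit_children v \<omega> = J} \<inter> (\<Inter>j\<in>J. space M - unit_path n (v @ [j]))" for J
  \<comment> \<open>For \<open>J = {}\<close> the inner intersection is \<open>UNIV\<close>, which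
    need not be an event, so this case is separate.\<close>
  have ev: "D J \<in> events" if "J \<subseteq> S" for J
  proof (cases "J = {}")
    case False
    then show ?thesis unfolding D_def
      using that v finite_subset[OF that finite_S]
      by (intro sets.Int unit_children_events sets.finite_INT sets.compl_sets unit_path_events) auto
  qed (use unit_children_events[OF v] in \<open>simp add: D_def\<close>)
  have "space M - unit_path (Suc n) v = (\<Union>J\<in>Pow S. D J)"
  proof (intro subset_antisym subsetI)
    fix \<omega> assume "\<omega> \<in> (\<Union>J\<in>Pow S. D J)"
    then have "\<omega> \<in> D (unit_children v \<omega>)" "\<omega> \<in> space M" by (auto simp: D_def)
    then have "\<forall>j\<in>unit_children v \<omega>. \<omega> \<notin> unit_path n (v @ [j])" unfolding D_def by blast
    then show "\<omega> \<in> space M - unit_path (Suc n) v" using \<open>\<omega> \<in> space M\<close> by (auto simp: unit_children_def)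
  next
    fix \<omega> assume "\<omega> \<in> space M - unit_path (Suc n) v"
    then have "\<omega> \<in> D (unit_children v \<omega>)" by (simp add: D_def) (auto simp: unit_children_def)
    then show "\<omega> \<in> (\<Union>J\<in>Pow S. D J)" by (auto simp: unit_children_def)
  qed
  then have "prob (space M - unit_path (Suc n) v) = prob (\<Union>J\<in>Pow S. D J)" by simp
  also have "\<dots> = (\<Sum>J\<in>Pow S. prob (D J))"
  proof (rule finite_measure_finite_Union)
    have "D J \<inter> D J' = {}" if "J \<noteq> J'" for J J'
      using that unfolding D_def by blast
    then show "disjoint_family_on D (Pow S)" by (simp add: disjoint_family_on_def)
  qed (use finite_S ev in auto)
  also have "\<dots> = (\<Sum>J\<in>Pow S. \<P>(\<omega> in M. unit_children [] \<omega> = J) * (\<Prod>j\<in>J. prob (space M - unit_path n (v @ [j]))))"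
  proof (rule sum.cong[OF refl])
    fix J assume "J \<in> Pow S"
    then show "prob (D J) = \<P>(\<omega> in M. unit_children [] \<omega> = J) * (\<Prod>j\<in>J. prob (space M - unit_path n (v @ [j])))"
      using prob_children_die_out[OF v, of J n] unfolding D_def prob_unit_children[OF v, of J] by simp
  qed
  finally show ?thesis .
qed

definition offspring_pgf :: "real \<Rightarrow> real" where
  "offspring_pgf q = (\<Sum>J\<in>Pow S. \<P>(\<omega> in M. unit_children [] \<omega> = J) * q ^ card J)"

text \<open>Subtrees at all nodes die out with the same probability, so the recursion becomes
  iteration of the generating function, as for a Galton-Watson process. It starts at
  \<open>0\<close> because generation \<open>0\<close> is always reached.\<close>

lemma prob_die_out_eq:
  "v \<in> lists S \<Longrightarrow> prob (space M - unit_path n v) = (offspring_pgf ^^ n) 0"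
proof (induction n arbitrary: v)
  case 0
  show ?case by simp
next
  case (Suc n)
  define q where "q = (offspring_pgf ^^ n) 0"
  have "(\<Prod>j\<in>J. prob (space M - unit_path n (v @ [j]))) = q ^ card J" if J: "J \<in> Pow S" for J
  proof -
    have "prob (space M - unit_path n (v @ [j])) = q" if "j \<in> J" for j
      unfolding q_def using that J Suc.prems by (intro Suc.IH) auto
    then show ?thesis by simp
  qed
  then have "prob (space M - unit_path (Suc n) v) = offspring_pgf q"
    unfolding prob_die_out_Suc[OF Suc.prems] offspring_pgf_def
    by (intro sum.cong refl arg_cong2[where f="(*)"])
  then show ?case unfolding q_def funpow.simps o_apply .
qed

section \<open>Lower bounds for the survival probabilities\<close>

definition survival_prob :: "nat \<Rightarrow> real" where
  "survival_prob n = prob (unit_path n [])"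

lemma survival_prob_eq: "survival_prob n = 1 - (offspring_pgf ^^ n) 0"
  using prob_die_out_eq[OF lists.Nil, of n] prob_compl[OF unit_path_events[OF lists.Nil], of n]
  unfolding survival_prob_def by linarith

lemma survival_prob_0: "survival_prob 0 = 1"
  by (simp add: survival_prob_eq)

lemma survival_prob_Suc: "survival_prob (Suc n) = 1 - offspring_pgf (1 - survival_prob n)"
  by (simp add: survival_prob_eq)

lemma survival_prob_bounds: "0 \<le> survival_prob n" "survival_prob n \<le> 1"
  by (auto simp: survival_prob_def)

lemma offspring_pgf_mono:
  assumes "0 \<le> a" "a \<le> b"
  shows "offspring_pgf a \<le> offspring_pgf b"
  unfolding offspring_pgf_def using assms
  by (intro sum_mono mult_left_mono power_mono) auto

lemma sum_prob_unit_children: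
  assumes "A \<subseteq> Pow S"
  shows "(\<Sum>J\<in>A. \<P>(\<omega> in M. unit_children [] \<omega> = J)) = \<P>(\<omega> in M. unit_children [] \<omega> \<in> A)"
proof -
  have eq: "{\<omega> \<in> space M. unit_children [] \<omega> \<in> A} = (\<Union>J\<in>A. {\<omega> \<in> space M. unit_children [] \<omega> = J})"
    by auto
  have "prob (\<Union>J\<in>A. {\<omega> \<in> space M. unit_children [] \<omega> = J}) =
      (\<Sum>J\<in>A. \<P>(\<omega> in M. unit_children [] \<omega> = J))"
  proof (rule finite_measure_finite_Union)
    show "finite A" using finite_subset[OF assms] finite_S by simp
    show "(\<lambda>J. {\<omega> \<in> space M. unit_children [] \<omega> = J}) ` A \<subseteq> events"
      using unit_children_events[of "[]"] by blast
  qed (auto simp: disjoint_family_on_def)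
  then show ?thesis unfolding eq by (rule sym)
qed

text \<open>Double counting: \<open>card J\<close> is a sum of indicators over \<open>S\<close>, and
  after exchanging the sums the sets containing \<open>j\<close> make up the event that
  \<open>w [j]\<close> equals \<open>1\<close>.\<close>

lemma offspring_mean:
  "(\<Sum>J\<in>Pow S. \<P>(\<omega> in M. unit_children [] \<omega> = J) * card J) = (\<Sum>j\<in>S. \<P>(\<omega> in M. w [j] \<omega> = 1))"
proof -
  have "(\<Sum>J\<in>Pow S. \<P>(\<omega> in M. unit_children [] \<omega> = J) * card J) =
      (\<Sum>J\<in>Pow S. \<Sum>j\<in>S. if j \<in> J then \<P>(\<omega> in M. unit_children [] \<omega> = J) else 0)"
    using finite_S by (intro sum.cong) (auto simp: sum.If_cases Int_absorb1)
  also have "\<dots> = (\<Sum>j\<in>S. \<Sum>J\<in>Pow S. if j \<in> J then \<P>(\<omega> in M. unit_children [] \<omega> = J) else 0)"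
    by (rule sum.swap)
  also have "\<dots> = (\<Sum>j\<in>S. \<Sum>J\<in>{J\<in>Pow S. j \<in> J}. \<P>(\<omega> in M. unit_children [] \<omega> = J))"
    using finite_S by (intro sum.cong refl sum.inter_filter[symmetric]) auto
  also have "\<dots> = (\<Sum>j\<in>S. \<P>(\<omega> in M. w [j] \<omega> = 1))"
    by (intro sum.cong refl, subst sum_prob_unit_children)
      (auto intro!: arg_cong[where f=prob] simp: unit_children_def)
  finally show ?thesis .
qed

text \<open>Second-order estimate of the generating function at \<open>1\<close>: the linear
  coefficient is the mean offspring, and at most \<open>card S\<close> children bound the quadratic
  term.\<close>

lemma survival_step:
  fixes s :: real
  assumes s: "0 \<le> s" "s \<le> 1"
  shows "1 - offspring_pgf (1 - s) \<ge> (\<Sum>j\<in>S. \<P>(\<omega> in M. w [j] \<omega> = 1)) * s - (real (card S))\<^sup>2 * s\<^sup>2"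
proof -
  let ?p = "\<lambda>J. \<P>(\<omega> in M. unit_children [] \<omega> = J)"
  have p1: "(\<Sum>J\<in>Pow S. ?p J) = 1"
    using sum_prob_unit_children[of "Pow S"] prob_space by (auto simp: unit_children_def)
  have "offspring_pgf (1 - s) \<le> (\<Sum>J\<in>Pow S. ?p J * (1 - real (card J) * s + (real (card S))\<^sup>2 * s\<^sup>2))"
    unfolding offspring_pgf_def
  proof (intro sum_mono mult_left_mono)
    fix J assume "J \<in> Pow S"
    then have "(real (card J))\<^sup>2 * s\<^sup>2 \<le> (real (card S))\<^sup>2 * s\<^sup>2"
      using finite_S by (intro mult_right_mono power_mono) (auto intro: card_mono)
    then show "(1 - s) ^ card J \<le> 1 - real (card J) * s + (real (card S))\<^sup>2 * s\<^sup>2"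
      using power_one_minus_le[OF s, of "card J"] by linarith
  qed simp
  also have "\<dots> = (\<Sum>J\<in>Pow S. ?p J) - (\<Sum>J\<in>Pow S. ?p J * card J) * s + (\<Sum>J\<in>Pow S. ?p J) * ((real (card S))\<^sup>2 * s\<^sup>2)"
    unfolding sum_distrib_right sum_subtractf[symmetric] sum.distrib[symmetric]
    by (simp add: algebra_simps)
  finally show ?thesis unfolding p1 offspring_mean by simp
qed

text \<open>The quadratic lower bound is not monotone in the survival probability, so the estimate
  first moves to \<open>a\<close> by monotonicity of the generating function and is expanded only
  there.\<close>

lemma survival_prob_Suc_ge:
  assumes a: "0 \<le> a" "a \<le> survival_prob n"
  shows "survival_prob (Suc n) \<ge> (\<Sum>j\<in>S. \<P>(\<omega> in M. w [j] \<omega> = 1)) * a - (real (card S))\<^sup>2 * a\<^sup>2"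
proof -
  have "offspring_pgf (1 - survival_prob n) \<le> offspring_pgf (1 - a)"
    using a survival_prob_bounds[of n] by (intro offspring_pgf_mono) auto
  then show ?thesis
    using survival_step[of a] a survival_prob_bounds[of n] by (simp add: survival_prob_Suc)
qed

section \<open>The critical and supercritical cases\<close>

lemma card_S_pos: "0 < card S"
  using finite_S S_nonempty by (simp add: card_gt_0_iff)

theorem critical_mean_infinite:
  assumes crit: "(\<Sum>j\<in>S. \<P>(\<omega> in M. w [j] \<omega> = 1)) = 1"
  shows "(\<integral>\<^sup>+\<omega>. cascade_height S w \<omega> \<partial>M) = \<infinity>"
proof -
  define C where "C = (real (card S))\<^sup>2"
  have C: "C \<ge> 1" using card_S_pos by (simp add: C_def)
  \<comment> \<open>With \<open>a = 1 / (2 * C * k)\<close> one has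
    \<open>a - C * a\<^sup>2 = (2 * k - 1) / (4 * C * k\<^sup>2)\<close>. That this is at least
    \<open>1 / (2 * C * (k + 1))\<close> amounts to
    \<open>2 * k\<^sup>2 \<le> (2 * k - 1) * (k + 1)\<close>, true for
    \<open>k \<ge> 1\<close>.\<close>
  have s: "survival_prob n \<ge> 1 / (2 * C * real (Suc n))" for n
  proof (induction n)
    case 0
    then show ?case using C by (simp add: survival_prob_0)
  next
    case (Suc n)
    define k where "k = real (Suc n)"
    have k: "k > 0" by (simp add: k_def)
    have "(4 * C * k\<^sup>2) * 1 \<le> (2 * k - 1) * (2 * C * (k + 1))"
    proof -
      have "2 * k\<^sup>2 \<le> (2 * k - 1) * (k + 1)"
        by (simp add: k_def algebra_simps power2_eq_square)
      then have "2 * C * (2 * k\<^sup>2) \<le> 2 * C * ((2 * k - 1) * (k + 1))"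
        using C by (intro mult_left_mono) auto
      then show ?thesis by (simp add: algebra_simps)
    qed
    moreover have "0 < 2 * C * (k + 1)" "0 < 4 * C * k\<^sup>2" using C k by auto
    ultimately have "1 \<le> (2 * k - 1) * (2 * C * (k + 1)) / (4 * C * k\<^sup>2)"
      using mult_imp_le_div_pos[of "4 * C * k\<^sup>2" 1] by (simp only: mult.commute[of _ 1])
    then have "1 / (2 * C * (k + 1)) \<le> (2 * k - 1) / (4 * C * k\<^sup>2)"
      using \<open>0 < 2 * C * (k + 1)\<close> by (intro mult_imp_div_pos_le) (simp_all only: times_divide_eq_left)
    also have "\<dots> = 1 / (2 * C * k) - C * (1 / (2 * C * k))\<^sup>2"
      using C k by (simp add: field_simps power2_eq_square)
    also have "\<dots> \<le> survival_prob (Suc n)"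
      using survival_prob_Suc_ge[of "1 / (2 * C * k)" n] Suc C k
      by (simp add: crit C_def[symmetric] k_def)
    finally show ?case by (simp add: k_def add.commute)
  qed
  \<comment> \<open>If generation \<open>K\<close> is reached, \<open>H \<ge> K + 1\<close> bounds
    all \<open>K + 1\<close> indicators at once; otherwise the new indicator is
    \<open>0\<close>.\<close>
  have part: "(\<Sum>n<K. indicator (unit_path n []) \<omega>) \<le> cascade_height S w \<omega>" for K \<omega>
  proof (induction K)
    case (Suc K)
    show ?case
    proof (cases "\<omega> \<in> unit_path K []")
      case True
      have "(\<Sum>n<Suc K. indicator (unit_path n []) \<omega>) \<le> (\<Sum>n<Suc K. 1::ennreal)"
        by (intro sum_mono) (auto simp: indicator_def)
      also have "\<dots> \<le> cascade_height S w \<omega>" using cascade_height_unit_path[OF True] by simp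
      finally show ?thesis .
    qed (use Suc in simp)
  qed simp
  have le: "ennreal (\<Sum>n<K. survival_prob n) \<le> (\<integral>\<^sup>+\<omega>. cascade_height S w \<omega> \<partial>M)" for K
  proof -
    have "ennreal (\<Sum>n<K. survival_prob n) = (\<Sum>n<K. emeasure M (unit_path n []))"
      by (simp add: survival_prob_def emeasure_eq_measure sum_ennreal)
    also have "\<dots> = (\<integral>\<^sup>+\<omega>. (\<Sum>n<K. indicator (unit_path n []) \<omega>) \<partial>M)"
      using unit_path_events[of "[]"] by (simp add: nn_integral_sum)
    also have "\<dots> \<le> (\<integral>\<^sup>+\<omega>. cascade_height S w \<omega> \<partial>M)"
      by (intro nn_integral_mono part)
    finally show ?thesis .
  qed
  show ?thesis
  proof (rule ccontr)
    assume "\<not> ?thesis"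
    then obtain h where h: "h \<ge> 0" "(\<integral>\<^sup>+\<omega>. cascade_height S w \<omega> \<partial>M) = ennreal h"
      by (cases "\<integral>\<^sup>+\<omega>. cascade_height S w \<omega> \<partial>M") auto
    \<comment> \<open>A finite mean would make the survival probabilities summable, hence by
      comparison the harmonic series.\<close>
    have "(\<Sum>n\<le>K. survival_prob n) \<le> h" for K using le[of "Suc K"] h by (simp add: lessThan_Suc_atMost)
    then have "summable survival_prob"
      using survival_prob_bounds(1) by (intro bounded_imp_summable[where B=h]) auto
    then have "summable (\<lambda>n. 1 / (2 * C * real (Suc n)))"
      using s C by (rule_tac summable_comparison_test'[where N=0]) auto
    then have "summable (\<lambda>n. 2 * C * (1 / (2 * C * real (Suc n))))" by (rule summable_mult)
    then have "summable (\<lambda>n. inverse (real (Suc n)))" using C by (simp add: inverse_eq_divide)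
    then show False using not_summable_harmonic[where 'a=real] summable_Suc_iff by blast
  qed
qed

theorem supercritical_prob_infinite:
  assumes sup: "(\<Sum>j\<in>S. \<P>(\<omega> in M. w [j] \<omega> = 1)) > 1"
  shows "\<P>(\<omega> in M. cascade_height S w \<omega> = \<infinity>) > 0"
proof -
  define C where "C = (real (card S))\<^sup>2"
  define m where "m = (\<Sum>j\<in>S. \<P>(\<omega> in M. w [j] \<omega> = 1))"
  have C: "C \<ge> 1" using card_S_pos by (simp add: C_def)
  \<comment> \<open>Chosen so that \<open>C * a \<le> m - 1\<close>, which makes \<open>a\<close> a
    lower barrier preserved by the recursion; the cap \<open>1\<close> is for generation
    \<open>0\<close>.\<close>
  define a where "a = min 1 ((m - 1) / C)"
  have a: "a > 0" using C sup by (simp add: a_def m_def)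
  have "C * a \<le> m - 1" using C by (simp add: a_def min_def field_simps)
  then have "C * a * a \<le> (m - 1) * a" using a by (intro mult_right_mono) auto
  then have step: "a \<le> m * a - C * a\<^sup>2" by (simp add: algebra_simps power2_eq_square)
  have s: "a \<le> survival_prob n" for n
  proof (induction n)
    case (Suc n)
    then show ?case using survival_prob_Suc_ge[of a n] a step by (simp add: m_def C_def)
  qed (simp add: survival_prob_0 a_def)
  \<comment> \<open>The survival events decrease, so continuity from above carries the bound
    \<open>a\<close> to their intersection, on which \<open>H\<close> exceeds every natural
    number.\<close>
  have "(\<lambda>n. survival_prob n) \<longlonglongrightarrow> prob (\<Inter>n. unit_path n [])"
    unfolding survival_prob_def
  proof (rule finite_Lim_measure_decseq)
    show "decseq (\<lambda>n. unit_path n [])" by (intro decseq_SucI unit_path_antimono)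
  qed (use unit_path_events[of "[]"] in auto)
  then have "a \<le> prob (\<Inter>n. unit_path n [])" by (rule LIMSEQ_le_const) (use s in auto)
  also have "\<dots> \<le> \<P>(\<omega> in M. cascade_height S w \<omega> = \<infinity>)"
  proof (rule finite_measure_mono)
    have "cascade_height S w \<omega> = \<infinity>" if "\<omega> \<in> (\<Inter>n. unit_path n [])" for \<omega>
    proof (rule ccontr)
      assume "cascade_height S w \<omega> \<noteq> \<infinity>"
      then obtain n where "cascade_height S w \<omega> < of_nat n"
        using ennreal_Ex_less_of_nat[of "cascade_height S w \<omega>"] by (auto simp: less_top)
      moreover have "of_nat n \<le> (of_nat (Suc n) :: ennreal)" by (rule of_nat_mono) simp
      moreover have "of_nat (Suc n) \<le> cascade_height S w \<omega>"
        using that by (intro cascade_height_unit_path) blast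
      ultimately show False by (meson leD order_trans)
    qed
    then show "(\<Inter>n. unit_path n []) \<subseteq> {\<omega> \<in> space M. cascade_height S w \<omega> = \<infinity>}"
      using unit_path_sub_space by blast
    show "{\<omega> \<in> space M. cascade_height S w \<omega> = \<infinity>} \<in> events"
      using measurable_cascade_height by measurable
  qed
  finally show ?thesis using a by linarith
qed

end

theorem theorem2:
  fixes M :: "'w measure" and S :: "'s set" and w :: "'s list \<Rightarrow> 'w \<Rightarrow> real"
  assumes "multiplicative_cascade M S w"
  shows
    "((\<Sum>i\<in>S. \<P>(\<omega> in M. w [i] \<omega> = 1)) < 1 \<longrightarrow>
        (\<forall>d::real. (\<integral>\<^sup>+\<omega>. ennreal_powr (cascade_height S w \<omega>) d \<partial>M) < \<infinity>)) \<and>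
     ((\<Sum>i\<in>S. \<P>(\<omega> in M. w [i] \<omega> = 1)) = 1 \<longrightarrow>
        (\<integral>\<^sup>+\<omega>. cascade_height S w \<omega> \<partial>M) = \<infinity>) \<and>
     ((\<Sum>i\<in>S. \<P>(\<omega> in M. w [i] \<omega> = 1)) > 1 \<longrightarrow>
        \<P>(\<omega> in M. cascade_height S w \<omega> = \<infinity>) > 0)"
proof -
  interpret multiplicative_cascade M S w by fact
  show ?thesis
    using subcritical_moments_finite critical_mean_infinite supercritical_prob_infinite by blast
qed

end
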